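(* For any integer $d\geq 8$, any real $\gamma\geq 1$, and any real $0<\varepsilon<\frac{1}{16}$, there are a positive integer $n$ and positive semi-definite real $d\times d$ matrices $Q_1,\ldots,Q_n$ with $I\in\mathrm{conv}\{Q_1,\ldots,Q_n\}$ and $\|Q_i\|\leq 2\gamma$ for all $i\in[n]$ such that, for any non-empty multi-subset $\sigma$ of $[n]$ of size $$|\sigma|\leq \gamma\,\frac{\lfloor\log_2 d\rfloor}{96\,\varepsilon},$$ we have $$\left\|\frac{1}{|\sigma|}\sum_{i\in\sigma}Q_i-I\right\|\geq\varepsilon .$$
   Context: $[n]=\{1,\ldots,n\}$. $I$ is the $d\times d$ identity matrix, $\mathrm{conv}$ denotes the convex hull, and $\|\cdot\|$ is the operator norm of a matrix induced by the Euclidean norm. Positive semi-definite matrices are understood to be symmetric. A multi-subset $\sigma$ of $[n]$ may contain elements repeatedly; $|\sigma|$ is its cardinality counted with multiplicity, and sums over $i\in\sigma$ are taken with multiplicity. *)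

theory Defs
  imports "HOL-Analysis.Analysis" "HOL-Library.Multiset"
begin

definition psd :: "real ^ 'n ^ 'n \<Rightarrow> bool" where
  "psd A \<longleftrightarrow> transpose A = A \<and> (\<forall>x. 0 \<le> x \<bullet> (A *v x))"

(* The library's norm on real ^ 'n ^ 'n is the Frobenius norm, so the operator norm
   induced by the Euclidean norm needs its own name. *)
definition opnorm :: "real ^ 'n ^ 'm \<Rightarrow> real" where
  "opnorm A = onorm (\<lambda>x. A *v x)"

end

theory Submission
  imports Defs
begin

text \<open>
  Take diagonal matrices whose \<open>2 ^ k\<close> diagonal positions (\<open>k = \<lfloor>log\<^sub>2 d\<rfloor>\<close>) are labelled by
  the subsets of \<open>{1..k}\<close>: the \<open>j\<close>-th matrix has entry \<open>2 * \<gamma>\<close> at the subsets containing \<open>j\<close>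
  and \<open>0\<close> elsewhere.  Give each of these \<open>k\<close> matrices the tiny weight
  \<open>t = 4 * \<epsilon> / (\<gamma> * k)\<close>, and let one further matrix complete the convex combination to the identity.
  A multiset of size at most \<open>1 / (24 * t)\<close> cannot reproduce a weight \<open>t\<close>: each of the \<open>k\<close> weights
  is missed by at least \<open>t\<close>, so the weight vector has \<open>l\<^sub>1\<close> error at least \<open>k * t\<close>.  Comparing the
  entries at the set of overweighted indices and at its complement turns this into an entry of size
  at least \<open>\<gamma> * k * t / 2 = 2 * \<epsilon>\<close>.
\<close>

definition diag_mat :: "('n \<Rightarrow> real) \<Rightarrow> real ^ 'n ^ 'n" where
  "diag_mat v = (\<chi> i j. if i = j then v i else 0)"

lemma diag_mat_mult_vec: "diag_mat v *v x = (\<chi> i. v i * x $ i)"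
  by (simp add: diag_mat_def matrix_vector_mult_def vec_eq_iff if_distrib[of "\<lambda>a. a * _"] cong: if_cong)

lemma psd_diag_mat:
  assumes "\<And>i. 0 \<le> v i"
  shows "psd (diag_mat v)"
proof -
  have "transpose (diag_mat v) = diag_mat v"
    by (auto simp: diag_mat_def transpose_def vec_eq_iff)
  moreover have "0 \<le> x \<bullet> (diag_mat v *v x)" for x
    unfolding diag_mat_mult_vec inner_vec_def
    by (rule sum_nonneg) (simp add: assms mult.left_commute[of "x $ _" "v _"])
  ultimately show ?thesis by (simp add: psd_def)
qed

lemma opnorm_diag_mat_le:
  assumes "\<And>i. \<bar>v i\<bar> \<le> B"
  shows "opnorm (diag_mat v) \<le> B"
  unfolding opnorm_def
proof (rule onorm_le)
  fix x :: "real ^ 'a"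
  have B: "0 \<le> B" using assms[of undefined] by linarith
  have "norm (diag_mat v *v x) \<le> norm (B *\<^sub>R x)"
    by (rule norm_le_componentwise_cart)
      (use assms B in \<open>simp add: diag_mat_mult_vec abs_mult mult_right_mono\<close>)
  then show "norm (diag_mat v *v x) \<le> B * norm x" using B by simp
qed

lemma sum_mset_entry:
  fixes Q :: "'b \<Rightarrow> real ^ 'n ^ 'm"
  shows "(\<Sum>i\<in>#\<sigma>. Q i) $ a $ b = (\<Sum>i\<in>#\<sigma>. Q i $ a $ b)"
  by (induction \<sigma>) auto

lemma sum_mset_eq_sum_count:
  fixes f :: "'b \<Rightarrow> real"
  assumes "finite A" "set_mset \<sigma> \<subseteq> A"
  shows "(\<Sum>i\<in>#\<sigma>. f i) = (\<Sum>i\<in>A. real (count \<sigma> i) * f i)"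
  using assms(2)
proof (induction \<sigma>)
  case (add x \<sigma>)
  have "(\<Sum>i\<in>A. real (count (add_mset x \<sigma>) i) * f i)
      = (\<Sum>i\<in>A. real (count \<sigma> i) * f i + (if i = x then f i else 0))"
    by (rule sum.cong) (auto simp: algebra_simps)
  also have "\<dots> = (\<Sum>i\<in>A. real (count \<sigma> i) * f i) + f x"
    using add.prems assms(1) by (simp add: sum.distrib)
  finally show ?case using add by simp
qed simp

text \<open>Inverting an injection of \<open>Pow {1..k}\<close> into the index type yields the
  labelling. Only the occurrence of every subset as a label matters; surplus positions may carry any
  set of naturals.\<close>

lemma exists_surj_Pow:
  assumes "2 ^ k \<le> CARD('d::finite)"
  shows "\<exists>f :: 'd \<Rightarrow> nat set. \<forall>S. S \<subseteq> {1..k} \<longrightarrow> S \<in> range f"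
proof -
  have "card (Pow {1..k}) \<le> card (UNIV :: 'd set)" using assms by (simp add: card_Pow)
  then obtain g :: "nat set \<Rightarrow> 'd" where "inj_on g (Pow {1..k})"
    using card_le_inj[of "Pow {1..k}" "UNIV :: 'd set"] by auto
  then have "inv_into (Pow {1..k}) g (g S) = S" if "S \<subseteq> {1..k}" for S
    using that by (simp add: inv_into_f_f)
  then show ?thesis by (metis rangeI)
qed

text \<open>
  Here \<open>b j S\<close> is the entry of the \<open>j\<close>-th matrix at \<open>S\<close>, \<open>r S\<close> that of the completing matrix,
  \<open>x j\<close> the weight error at \<open>j\<close>, and \<open>- (\<Sum>j\<in>J. x j)\<close> the resulting error of the completing weight.
\<close>

lemma exists_large_deviation:
  fixes x :: "'i \<Rightarrow> real" and b :: "'i \<Rightarrow> 'i set \<Rightarrow> real" and r :: "'i set \<Rightarrow> real" and J :: "'i set"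
  defines "dev \<equiv> \<lambda>S. (\<Sum>j\<in>J. x j * b j S) - (\<Sum>j\<in>J. x j) * r S"
  assumes b: "\<And>j S. b j S = (if j \<in> S then 2 * \<gamma> else 0)"
    and r: "\<And>S T. S \<subseteq> J \<Longrightarrow> T \<subseteq> J \<Longrightarrow> \<bar>r S - r T\<bar> \<le> \<gamma>"
  shows "\<exists>S\<subseteq>J. \<gamma> * (\<Sum>j\<in>J. \<bar>x j\<bar>) \<le> 2 * \<bar>dev S\<bar>"
proof -
  define S where "S = {j \<in> J. x j > 0}"
  define T where "T = J - S"
  have ST: "S \<subseteq> J" "T \<subseteq> J" by (auto simp: S_def T_def)
  let ?N = "\<Sum>j\<in>J. \<bar>x j\<bar>"
  have "(\<Sum>j\<in>J. x j * b j S) - (\<Sum>j\<in>J. x j * b j T) = (\<Sum>j\<in>J. 2 * \<gamma> * \<bar>x j\<bar>)"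
    unfolding sum_subtractf[symmetric] by (rule sum.cong) (auto simp: b S_def T_def)
  then have "(\<Sum>j\<in>J. x j * b j S) - (\<Sum>j\<in>J. x j * b j T) = 2 * \<gamma> * ?N"
    by (simp add: sum_distrib_left)
  then have eq: "dev S - dev T = 2 * \<gamma> * ?N - (\<Sum>j\<in>J. x j) * (r S - r T)"
    by (simp add: dev_def algebra_simps)
  \<comment> \<open>The completing matrix can cancel at most half of the gap
    \<open>2 * \<gamma> * ?N\<close>; what remains is shared by \<open>S\<close> and
    \<open>T\<close>, so one of them carries at least half of it.\<close>
  have "\<bar>(\<Sum>j\<in>J. x j) * (r S - r T)\<bar> \<le> ?N * \<gamma>"
    unfolding abs_mult by (intro mult_mono sum_abs r ST sum_nonneg) auto
  then have "\<gamma> * ?N \<le> dev S - dev T"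
    unfolding eq by (simp add: mult.commute[of \<gamma>] abs_le_iff)
  then have "\<gamma> * ?N \<le> 2 * \<bar>dev S\<bar> \<or> \<gamma> * ?N \<le> 2 * \<bar>dev T\<bar>" by linarith
  with ST show ?thesis by blast
qed

theorem theorem1p2:
  fixes \<gamma> \<epsilon> :: real
  assumes "CARD('d::finite) \<ge> 8"
    and "\<gamma> \<ge> 1"
    and "0 < \<epsilon>" and "\<epsilon> < 1 / 16"
  shows "\<exists>(n::nat) (Q :: nat \<Rightarrow> real ^ 'd ^ 'd).
    n > 0 \<and>
    (\<forall>i\<in>{1..n}. psd (Q i)) \<and>
    mat 1 \<in> convex hull (Q ` {1..n}) \<and>
    (\<forall>i\<in>{1..n}. opnorm (Q i) \<le> 2 * \<gamma>) \<and>
    (\<forall>\<sigma> :: nat multiset.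
       \<sigma> \<noteq> {#} \<longrightarrow> set_mset \<sigma> \<subseteq> {1..n} \<longrightarrow>
       real (size \<sigma>) \<le> \<gamma> * (real_of_int \<lfloor>log 2 (real CARD('d))\<rfloor> / (96 * \<epsilon>)) \<longrightarrow>
       opnorm ((1 / real (size \<sigma>)) *\<^sub>R (\<Sum>i\<in>#\<sigma>. Q i) - mat 1) \<ge> \<epsilon>)"
proof -
  define k where "k = nat \<lfloor>log 2 (real CARD('d))\<rfloor>"
  have "log 2 (real CARD('d)) \<ge> 1"
    using assms(1) by (simp add: le_log_iff)
  then have fl1: "\<lfloor>log 2 (real CARD('d))\<rfloor> \<ge> 1" by (simp add: le_floor_iff)
  then have kpos: "k > 0" and kfl: "real_of_int \<lfloor>log 2 (real CARD('d))\<rfloor> = real k"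
    by (auto simp: k_def)
  have "real k \<le> log 2 (real CARD('d))" unfolding kfl[symmetric] by simp
  then have "2 powr real k \<le> real CARD('d)"
    by (subst (asm) le_log_iff) auto
  then have "real (2 ^ k) \<le> real CARD('d)" by (simp add: powr_realpow)
  then have "2 ^ k \<le> CARD('d)" by linarith
  then obtain f :: "'d \<Rightarrow> nat set" where f: "\<And>S. S \<subseteq> {1..k} \<Longrightarrow> S \<in> range f"
    using exists_surj_Pow by metis

  define t where "t = 4 * \<epsilon> / (\<gamma> * k)"
  have tpos: "t > 0" using assms kpos by (simp add: t_def)
  have gkt: "\<gamma> * (k * t) = 4 * \<epsilon>" using assms kpos by (simp add: t_def)
  have "k * t \<le> \<gamma> * (k * t)" 
    using mult_right_mono[OF assms(2), of "k * t"] tpos by simp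
  then have kt: "k * t \<le> 1 / 4" using gkt assms by linarith
  define b where "b = (\<lambda>j S. if (j::nat) \<in> S then 2 * \<gamma> else 0)"
  define s where "s = (\<lambda>S. t * (\<Sum>j\<in>{1..k}. b j S))"
  \<comment> \<open>Solves \<open>s S + (1 - k * t) * r S = 1\<close>, so that weights
    \<open>t\<close> and \<open>1 - k * t\<close> give the identity.\<close>
  define r where "r = (\<lambda>S. (1 - s S) / (1 - k * t))"
  \<comment> \<open>The bounds hold for arbitrary \<open>S\<close>, since labels need not lie within
    \<open>{1..k}\<close>.\<close>
  have s0: "0 \<le> s S" for S
    using tpos assms unfolding s_def b_def by (intro mult_nonneg_nonneg sum_nonneg) auto
  have "(\<Sum>j\<in>{1..k}. b j S) \<le> of_nat (card {1..k}) * (2 * \<gamma>)" for S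
    using assms by (intro sum_bounded_above) (auto simp: b_def)
  then have "s S \<le> t * (k * (2 * \<gamma>))" for S
    unfolding s_def using tpos by (intro mult_left_mono) auto
  moreover have "t * (k * (2 * \<gamma>)) = 8 * \<epsilon>" using gkt by (simp add: algebra_simps)
  ultimately have "s S \<le> 8 * \<epsilon>" for S by simp
  then have s1: "s S \<le> 1 / 2" for S
    by (rule order_trans) (use assms(4) in simp)
  have r0: "0 \<le> r S" for S using s1[of S] kt by (simp add: r_def)
  have r2: "r S \<le> 2" for S using s0[of S] kt by (simp add: r_def divide_simps)
  have rdiff: "\<bar>r S - r T\<bar> \<le> \<gamma>" for S T
  proof -
    have "r S - r T = (s T - s S) / (1 - k * t)" by (simp add: r_def diff_divide_distrib)
    \<comment> \<open>The numerator is at most \<open>1 / 2\<close> in absolute value and the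
      denominator at least \<open>3 / 4\<close>.\<close>
    also have "\<bar>\<dots>\<bar> \<le> 1"
      using s0[of S] s0[of T] s1[of S] s1[of T] kt by (simp add: abs_le_iff divide_simps)
    finally show ?thesis using assms by linarith
  qed

  define q where "q = (\<lambda>i S. if i = Suc k then r S else b i S)"
  define Q :: "nat \<Rightarrow> real ^ 'd ^ 'd" where "Q = (\<lambda>i. diag_mat (\<lambda>a. q i (f a)))"
  have q0: "0 \<le> q i S" and q2: "q i S \<le> 2 * \<gamma>" for i S
    using r0[of S] r2[of S] assms by (auto simp: q_def b_def)
  have split: "(\<Sum>i\<in>{1..Suc k}. g i) = (\<Sum>i\<in>{1..k}. g i) + g (Suc k)" for g :: "nat \<Rightarrow> 'z::comm_monoid_add"
    by simp
  have qsplit: "(\<Sum>i\<in>{1..Suc k}. g i * q i S) = (\<Sum>i\<in>{1..k}. g i * b i S) + g (Suc k) * r S"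
    for g :: "nat \<Rightarrow> real" and S
    by (simp add: q_def)

  have hull: "mat 1 \<in> convex hull (Q ` {1..Suc k})"
  proof -
    define u where "u = (\<lambda>i. if i = Suc k then 1 - k * t else t)"
    have "(\<Sum>i\<in>{1..Suc k}. u i * q i S) = 1" for S
      unfolding qsplit using kt
      by (simp add: u_def r_def s_def sum_distrib_left)
    then have "(\<Sum>i\<in>{1..Suc k}. u i *\<^sub>R Q i) = mat 1"
      by (simp add: vec_eq_iff Q_def diag_mat_def mat_def)
    moreover have "(\<Sum>i\<in>{1..Suc k}. u i *\<^sub>R Q i) \<in> convex hull (Q ` {1..Suc k})"
    proof (rule convex_sum)
      show "(\<Sum>i\<in>{1..Suc k}. u i) = 1" by (simp add: u_def)
      show "0 \<le> u i" for i using tpos kt by (simp add: u_def)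
    qed (auto intro: hull_inc)
    ultimately show ?thesis by simp
  qed

  have dev: "\<epsilon> \<le> opnorm ((1 / real (size \<sigma>)) *\<^sub>R (\<Sum>i\<in>#\<sigma>. Q i) - mat 1)"
    if ne: "\<sigma> \<noteq> {#}" and sub: "set_mset \<sigma> \<subseteq> {1..Suc k}"
      and small: "real (size \<sigma>) \<le> \<gamma> * (real k / (96 * \<epsilon>))" for \<sigma>
  proof -
    let ?m = "real (size \<sigma>)"
    let ?A = "(1 / ?m) *\<^sub>R (\<Sum>i\<in>#\<sigma>. Q i) - mat 1"
    have m: "?m > 0" using ne by (simp add: nonempty_has_size)
    define w where "w = (\<lambda>i. real (count \<sigma> i) / ?m)"
    define x where "x = (\<lambda>i. w i - t)"
    have "?m = (\<Sum>i\<in>{1..Suc k}. real (count \<sigma> i))"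
      using sum_mset_eq_sum_count[OF _ sub, of "\<lambda>_. 1"] by simp
    then have "(\<Sum>i\<in>{1..Suc k}. w i) = 1"
      using m unfolding w_def sum_divide_distrib[symmetric] by simp
    \<comment> \<open>Both weight vectors sum to 1, so the completing weight absorbs all the other
      errors.\<close>
    then have wlast: "w (Suc k) = 1 - k * t - (\<Sum>i\<in>{1..k}. x i)"
      unfolding split by (simp add: x_def sum_subtractf)
    have entry: "?A $ a $ a = (\<Sum>j\<in>{1..k}. x j * b j (f a)) - (\<Sum>j\<in>{1..k}. x j) * r (f a)" for a
    proof -
      have "?A $ a $ a = (\<Sum>i\<in>#\<sigma>. q i (f a)) / ?m - 1"
        by (simp add: sum_mset_entry Q_def diag_mat_def mat_def)
      also have "(\<Sum>i\<in>#\<sigma>. q i (f a)) / ?m = (\<Sum>i\<in>{1..Suc k}. w i * q i (f a))"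
        unfolding sum_mset_eq_sum_count[OF finite_atLeastAtMost sub]
        by (simp only: w_def sum_divide_distrib times_divide_eq_left)
      also have "\<dots> = (\<Sum>i\<in>{1..k}. w i * b i (f a)) + w (Suc k) * r (f a)"
        by (rule qsplit)
      also have "(\<Sum>i\<in>{1..k}. w i * b i (f a)) = (\<Sum>i\<in>{1..k}. x i * b i (f a)) + s (f a)"
        by (simp add: x_def s_def sum_distrib_left algebra_simps flip: sum.distrib)
      also have "w (Suc k) * r (f a) = 1 - s (f a) - (\<Sum>i\<in>{1..k}. x i) * r (f a)"
        unfolding wlast left_diff_distrib[of "1 - k * t"] using kt by (simp add: r_def)
      finally show ?thesis by simp
    qed
    have "24 * t * ?m \<le> 1"
      using small assms kpos by (simp add: t_def field_simps)
    then have tm: "24 * t \<le> 1 / ?m" using m by (simp add: field_simps)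
    \<comment> \<open>Weights are multiples of \<open>1 / ?m\<close>, which is at least
      \<open>24 * t\<close>: an absent index errs by exactly \<open>t\<close>, a present one by at
      least \<open>23 * t\<close>.\<close>
    have "t \<le> \<bar>x i\<bar>" for i
    proof (cases "count \<sigma> i = 0")
      case False
      then have "1 / ?m \<le> w i" using m by (simp add: w_def divide_right_mono)
      then show ?thesis using tm tpos by (simp add: x_def)
    qed (use tpos in \<open>simp add: x_def w_def\<close>)
    then have "of_nat (card {1..k}) * t \<le> (\<Sum>j\<in>{1..k}. \<bar>x j\<bar>)"
      by (intro sum_bounded_below)
    then have "4 * \<epsilon> \<le> \<gamma> * (\<Sum>j\<in>{1..k}. \<bar>x j\<bar>)"
      unfolding gkt[symmetric] using assms by (intro mult_left_mono) auto
    moreover obtain S where "S \<subseteq> {1..k}"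
      and "\<gamma> * (\<Sum>j\<in>{1..k}. \<bar>x j\<bar>)
        \<le> 2 * \<bar>(\<Sum>j\<in>{1..k}. x j * b j S) - (\<Sum>j\<in>{1..k}. x j) * r S\<bar>"
      using exists_large_deviation[of b \<gamma> "{1..k}" r x] rdiff by (auto simp: b_def)
    moreover obtain a where "S = f a" using f[OF \<open>S \<subseteq> {1..k}\<close>] by blast
    ultimately have "4 * \<epsilon> \<le> 2 * \<bar>?A $ a $ a\<bar>" unfolding entry by simp
    \<comment> \<open>An entry never exceeds the operator norm in absolute value; the entry found is
      at least \<open>2 * \<epsilon>\<close>, twice what is required.\<close>
    then show ?thesis using matrix_component_le_onorm[of ?A a a] assms unfolding opnorm_def by linarith
  qed

  show ?thesis
    unfolding kfl
  proof (intro exI[of _ "Suc k"] exI[of _ Q] conjI ballI allI impI)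
    show "psd (Q i)" for i unfolding Q_def by (rule psd_diag_mat) (rule q0)
    show "opnorm (Q i) \<le> 2 * \<gamma>" for i
      unfolding Q_def by (rule opnorm_diag_mat_le) (use q0 q2 in simp)
  qed (use hull dev in auto)
qed

end
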